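(* Strongly finitary endofunctors on $\mathbf{Met}$ are not closed under composition: there exist strongly finitary endofunctors $F,G:\mathbf{Met}\to\mathbf{Met}$ whose composite $G\cdot F$ is not strongly finitary.
   Context: $\mathbf{Met}$ is the category of extended metric spaces (distance $\infty$ allowed) and nonexpanding maps. It is symmetric monoidal closed: the tensor product is the cartesian product with the sum metric, and hom-spaces carry the supremum metric $d(f,g)=\sup_x d(f(x),g(x))$. An endofunctor $F$ of $\mathbf{Met}$ is enriched iff $d(Ff,Fg)\le d(f,g)$ for all parallel pairs $f,g$. Let $K:\mathbf{Set}_f\to\mathbf{Met}$ be the full embedding of finite sets as finite discrete spaces (all nonzero distances $\infty$). An enriched endofunctor $T$ on $\mathbf{Met}$ is strongly finitary if it is the ($\mathbf{Met}$-enriched) left Kan extension along $K$ of its restriction to finite discrete spaces: $T=\mathrm{Lan}_K(TK)$. *)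

theory Defs
  imports
    "HOL-Library.Extended_Nonnegative_Real"
    "HOL-Library.FuncSet"
    "HOL-Library.Equipollence"
begin

section \<open>Extended metric spaces and nonexpanding maps\<close>

record 'a space =
  pts :: "'a set"
  dst :: "'a \<Rightarrow> 'a \<Rightarrow> ennreal"

text \<open>The distance function is normalised to \<open>0\<close> outside the underlying set, so that two
  spaces are equal as soon as they have the same points and the same distances between them.\<close>

definition ext_metric_space :: "'a space \<Rightarrow> bool" where
  "ext_metric_space M \<longleftrightarrow>
     (\<forall>x\<in>pts M. \<forall>y\<in>pts M. dst M x y = 0 \<longleftrightarrow> x = y) \<and>
     (\<forall>x\<in>pts M. \<forall>y\<in>pts M. dst M x y = dst M y x) \<and>
     (\<forall>x\<in>pts M. \<forall>y\<in>pts M. \<forall>z\<in>pts M. dst M x z \<le> dst M x y + dst M y z) \<and>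
     (\<forall>x y. x \<notin> pts M \<or> y \<notin> pts M \<longrightarrow> dst M x y = 0)"

text \<open>Maps are extensional functions, so equality of morphisms is equality in HOL.\<close>

definition nonexp :: "'a space \<Rightarrow> 'b space \<Rightarrow> ('a \<Rightarrow> 'b) set" where
  "nonexp M N = {f \<in> pts M \<rightarrow>\<^sub>E pts N.
     \<forall>x\<in>pts M. \<forall>y\<in>pts M. dst N (f x) (f y) \<le> dst M x y}"

definition hom_space :: "'a space \<Rightarrow> 'b space \<Rightarrow> ('a \<Rightarrow> 'b) space" where
  "hom_space M N =
     \<lparr>pts = nonexp M N,
      dst = (\<lambda>f g. if f \<in> nonexp M N \<and> g \<in> nonexp M N
                   then (SUP x\<in>pts M. dst N (f x) (g x)) else 0)\<rparr>"

text \<open>Isomorphisms of extended metric spaces: bijective isometries.\<close>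

definition isometric_iso :: "('a \<Rightarrow> 'b) \<Rightarrow> 'a space \<Rightarrow> 'b space \<Rightarrow> bool" where
  "isometric_iso f M N \<longleftrightarrow>
     bij_betw f (pts M) (pts N) \<and>
     (\<forall>x\<in>pts M. \<forall>y\<in>pts M. dst N (f x) (f y) = dst M x y)"

section \<open>The category of extended metric spaces and its enriched endofunctors\<close>

text \<open>The type \<open>'u\<close> plays the role of the universe: the objects are the spaces on
  small subsets of \<open>'u\<close>, where small means of cardinality strictly below that of \<open>'u\<close>.
  If the cardinality of \<open>'u\<close> is strongly inaccessible, this is (up to equivalence) the
  category of all extended metric spaces of a Grothendieck universe; if it is the successor
  of a cardinal \<open>k\<close>, these are the spaces of cardinality at most \<open>k\<close>.\<close>

definition Met :: "'u space set" where
  "Met = {M. ext_metric_space M \<and> pts M \<prec> (UNIV :: 'u set)}"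

text \<open>The action on morphisms takes domain and codomain as arguments, because an
  extensional function determines neither the metric of its domain nor its codomain.\<close>

record 'u endofunctor =
  ob :: "'u space \<Rightarrow> 'u space"
  ar :: "'u space \<Rightarrow> 'u space \<Rightarrow> ('u \<Rightarrow> 'u) \<Rightarrow> ('u \<Rightarrow> 'u)"

definition enriched_endofunctor :: "'u endofunctor \<Rightarrow> bool" where
  "enriched_endofunctor T \<longleftrightarrow>
     (\<forall>X\<in>Met. ob T X \<in> Met) \<and>
     (\<forall>X\<in>Met. \<forall>Y\<in>Met. \<forall>f\<in>nonexp X Y. ar T X Y f \<in> nonexp (ob T X) (ob T Y)) \<and>
     (\<forall>X\<in>Met. ar T X X (\<lambda>x\<in>pts X. x) = (\<lambda>x\<in>pts (ob T X). x)) \<and>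
     (\<forall>X\<in>Met. \<forall>Y\<in>Met. \<forall>Z\<in>Met. \<forall>f\<in>nonexp X Y. \<forall>g\<in>nonexp Y Z.
        ar T X Z (compose (pts X) g f) =
        compose (pts (ob T X)) (ar T Y Z g) (ar T X Y f)) \<and>
     (\<forall>X\<in>Met. \<forall>Y\<in>Met. \<forall>f\<in>nonexp X Y. \<forall>g\<in>nonexp X Y.
        dst (hom_space (ob T X) (ob T Y)) (ar T X Y f) (ar T X Y g)
          \<le> dst (hom_space X Y) f g)"

definition comp_endofunctor :: "'u endofunctor \<Rightarrow> 'u endofunctor \<Rightarrow> 'u endofunctor"
    (infixl "\<cdot>" 70) where
  "G \<cdot> F =
     \<lparr>ob = (\<lambda>X. ob G (ob F X)),
      ar = (\<lambda>X Y f. ar G (ob F X) (ob F Y) (ar F X Y f))\<rparr>"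

lemma enriched_endofunctor_comp:
  assumes F: "enriched_endofunctor F" and G: "enriched_endofunctor G"
  shows "enriched_endofunctor (G \<cdot> F)"
proof -
  have ob: "ob F X \<in> Met" if "X \<in> Met" for X
    using F that by (simp add: enriched_endofunctor_def)
  have ar: "ar F X Y f \<in> nonexp (ob F X) (ob F Y)"
    if "X \<in> Met" "Y \<in> Met" "f \<in> nonexp X Y" for X Y f
    using F that by (simp add: enriched_endofunctor_def)
  have enr: "dst (hom_space (ob G (ob F X)) (ob G (ob F Y)))
        (ar G (ob F X) (ob F Y) (ar F X Y f)) (ar G (ob F X) (ob F Y) (ar F X Y g))
        \<le> dst (hom_space X Y) f g"
    if "X \<in> Met" "Y \<in> Met" "f \<in> nonexp X Y" "g \<in> nonexp X Y" for X Y f g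
  proof -
    have "dst (hom_space (ob G (ob F X)) (ob G (ob F Y)))
        (ar G (ob F X) (ob F Y) (ar F X Y f)) (ar G (ob F X) (ob F Y) (ar F X Y g))
        \<le> dst (hom_space (ob F X) (ob F Y)) (ar F X Y f) (ar F X Y g)"
      using G that ob ar unfolding enriched_endofunctor_def by blast
    also have "\<dots> \<le> dst (hom_space X Y) f g"
      using F that unfolding enriched_endofunctor_def by blast
    finally show ?thesis .
  qed
  show ?thesis
    using F G unfolding enriched_endofunctor_def
    by (simp add: comp_endofunctor_def enr[simplified] ob ar)
qed

section \<open>Strongly finitary endofunctors\<close>

text \<open>The embedding of finite sets on objects; the sets are the finite subsets of \<open>'u\<close>. On
  morphisms it is the identity: \<open>nonexp (discrete S) (discrete S') = S \<rightarrow>\<^sub>E S'\<close>.\<close>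

definition discrete :: "'a set \<Rightarrow> 'a space" where
  "discrete S =
     \<lparr>pts = S, dst = (\<lambda>x y. if x \<in> S \<and> y \<in> S \<and> x \<noteq> y then \<infinity> else 0)\<rparr>"

lemma nonexp_discrete: "nonexp (discrete S) (discrete S') = S \<rightarrow>\<^sub>E S'"
  by (auto simp: nonexp_def discrete_def)

lemma discrete_in_Met:
  assumes "infinite (UNIV :: 'u set)" "finite (S :: 'u set)"
  shows "discrete S \<in> Met"
proof -
  have "ext_metric_space (discrete S)"
    by (auto simp: ext_metric_space_def discrete_def)
  moreover have "S \<prec> (UNIV :: 'u set)"
    using assms finite_lesspoll_infinite by blast
  ultimately show ?thesis
    by (simp add: Met_def discrete_def)
qed

text \<open>Write \<open>K\<close> for \<open>discrete\<close>. The space of natural transformations from the presheaf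
  \<open>Met(K-, X)\<close> to the presheaf \<open>Met(T K-, Y)\<close> on finite sets, with the supremum metric.
  Enriched naturality is ordinary naturality, as the underlying-set functor of \<open>Met\<close> is
  faithful.\<close>

definition weighted_cocones ::
  "'u endofunctor \<Rightarrow> 'u space \<Rightarrow> 'u space \<Rightarrow> ('u set \<Rightarrow> ('u \<Rightarrow> 'u) \<Rightarrow> ('u \<Rightarrow> 'u)) space" where
  "weighted_cocones T X Y =
     (let C = {\<phi> \<in> (\<Pi>\<^sub>E S\<in>{S. finite S}.
                nonexp (hom_space (discrete S) X) (hom_space (ob T (discrete S)) Y)).
              \<forall>S S'. finite S \<longrightarrow> finite S' \<longrightarrow>
                (\<forall>f\<in>nonexp (discrete S) (discrete S'). \<forall>g\<in>nonexp (discrete S') X.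
                   \<phi> S (compose S g f) =
                   compose (pts (ob T (discrete S))) (\<phi> S' g)
                     (ar T (discrete S) (discrete S') f))}
      in \<lparr>pts = C,
          dst = (\<lambda>\<phi> \<psi>. if \<phi> \<in> C \<and> \<psi> \<in> C
             then (SUP S\<in>{S. finite S}.
                     dst (hom_space (hom_space (discrete S) X)
                                    (hom_space (ob T (discrete S)) Y)) (\<phi> S) (\<psi> S))
             else 0)\<rparr>)"

definition lan_comparison ::
  "'u endofunctor \<Rightarrow> 'u space \<Rightarrow> 'u space \<Rightarrow>
     ('u \<Rightarrow> 'u) \<Rightarrow> ('u set \<Rightarrow> ('u \<Rightarrow> 'u) \<Rightarrow> ('u \<Rightarrow> 'u))" where
  "lan_comparison T X Y h =
     (\<lambda>S\<in>{S. finite S}. \<lambda>g\<in>nonexp (discrete S) X.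
        compose (pts (ob T (discrete S))) h (ar T (discrete S) X g))"

text \<open>\<open>T = Lan\<^sub>K (T K)\<close> in the sense of enriched category theory: for every \<open>X\<close>, the object
  \<open>T X\<close> is the colimit of \<open>T K\<close> weighted by \<open>Met(K-, X)\<close>, with colimit cocone given by
  the action of \<open>T\<close>, that is, \<open>h \<mapsto> (g \<mapsto> h \<circ> T g)\<close> is an isomorphism of spaces
  \<open>Met(T X, Y) \<cong> [Set\<^sub>f\<^sup>o\<^sup>p, Met](Met(K-, X), Met(T K-, Y))\<close> for all \<open>Y\<close>. (Since \<open>K\<close> is fully
  faithful, an arbitrary isomorphism of \<open>T\<close> with \<open>Lan\<^sub>K (T K)\<close> also yields this one.)\<close>

definition strongly_finitary :: "'u endofunctor \<Rightarrow> bool" where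
  "strongly_finitary T \<longleftrightarrow>
     enriched_endofunctor T \<and>
     (\<forall>X\<in>Met. \<forall>Y\<in>Met.
        isometric_iso (lan_comparison T X Y) (hom_space (ob T X) Y) (weighted_cocones T X Y))"

end

theory Submission
  imports Defs
begin

text \<open>Take \<open>F X = A \<otimes> X\<close> for a two-point space \<open>A\<close> with distance \<open>1\<close>, and \<open>G X = X \<times> X\<close> with the
  maximum metric. Both are strongly finitary: cocones are determined by a single generic element
  over a singleton and a two-element set, respectively. In \<open>G (F X)\<close> the distance of
  \<open>((a, x), (b, y))\<close> and \<open>((a', x'), (b', y'))\<close> is
  \<open>max (d(a, a') + d(x, x')) (d(b, b') + d(y, y'))\<close>, whereas in the Kan extension one first moves in
  \<open>A \<times> A\<close> and then in \<open>X \<times> X\<close>, so that the distance is the sum of the two maxima. The function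
  \<open>((a, x), (b, y)) \<mapsto> a + y\<close> for \<open>A = X = {0, 1}\<close> is nonexpanding for the latter metric only.\<close>

section \<open>A criterion for strong finitarity\<close>

lemma nonexpD:
  assumes "f \<in> nonexp M N"
  shows "f \<in> pts M \<rightarrow>\<^sub>E pts N"
    and "x \<in> pts M \<Longrightarrow> f x \<in> pts N"
    and "x \<in> pts M \<Longrightarrow> y \<in> pts M \<Longrightarrow> dst N (f x) (f y) \<le> dst M x y"
  using assms by (auto simp: nonexp_def)

lemma nonexp_eqI:
  assumes "f \<in> nonexp M N" "g \<in> nonexp M N" "\<And>x. x \<in> pts M \<Longrightarrow> f x = g x"
  shows "f = g"
  using nonexpD(1)[OF assms(1)] nonexpD(1)[OF assms(2)] assms(3) by (rule PiE_ext)

lemma nonexp_compose: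
  assumes "f \<in> nonexp L M" "g \<in> nonexp M N"
  shows "compose (pts L) g f \<in> nonexp L N"
  using nonexpD(2)[OF assms(1)] nonexpD(2)[OF assms(2)]
    order_trans[OF nonexpD(3)[OF assms(2)] nonexpD(3)[OF assms(1)]]
  unfolding nonexp_def by (auto simp: compose_def)

lemma pts_hom_space [simp]: "pts (hom_space M N) = nonexp M N"
  by (simp add: hom_space_def)

lemma dst_hom_space_le_iff:
  assumes "f \<in> nonexp M N" "g \<in> nonexp M N"
  shows "dst (hom_space M N) f g \<le> c \<longleftrightarrow> (\<forall>x\<in>pts M. dst N (f x) (g x) \<le> c)"
  using assms by (simp add: hom_space_def SUP_le_iff)

lemma dst_le_dst_hom_space:
  assumes "f \<in> nonexp M N" "g \<in> nonexp M N" "x \<in> pts M"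
  shows "dst N (f x) (g x) \<le> dst (hom_space M N) f g"
  using assms dst_hom_space_le_iff[of f M N g] by blast

lemma Met_dst_eq_0:
  assumes "M \<in> Met" "x \<in> pts M" "y \<in> pts M"
  shows "dst M x y = 0 \<longleftrightarrow> x = y"
  using assms by (simp add: Met_def ext_metric_space_def)

lemma Met_triangle:
  assumes "M \<in> Met" "x \<in> pts M" "y \<in> pts M" "z \<in> pts M"
  shows "dst M x z \<le> dst M x y + dst M y z"
  using assms by (simp add: Met_def ext_metric_space_def)

lemma Met_sym:
  assumes "M \<in> Met" "x \<in> pts M" "y \<in> pts M"
  shows "dst M x y = dst M y x"
  using assms by (simp add: Met_def ext_metric_space_def)

lemma enriched_endofunctorD:
  assumes "enriched_endofunctor T" "X \<in> Met" "Y \<in> Met"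
  shows "ob T X \<in> Met"
    and "f \<in> nonexp X Y \<Longrightarrow> ar T X Y f \<in> nonexp (ob T X) (ob T Y)"
    and "Z \<in> Met \<Longrightarrow> f \<in> nonexp X Y \<Longrightarrow> g \<in> nonexp Y Z \<Longrightarrow>
      ar T X Z (compose (pts X) g f) = compose (pts (ob T X)) (ar T Y Z g) (ar T X Y f)"
    and "f \<in> nonexp X Y \<Longrightarrow> g \<in> nonexp X Y \<Longrightarrow>
      dst (hom_space (ob T X) (ob T Y)) (ar T X Y f) (ar T X Y g) \<le> dst (hom_space X Y) f g"
  using assms unfolding enriched_endofunctor_def by blast+

text \<open>Morphisms are extensional, so the functor laws can be tested at points. A bound on the
  supremum metric is a bound at every point, so enrichment can be tested there too.\<close>

lemma enriched_endofunctorI: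
  fixes T :: "'u endofunctor"
  assumes ob: "\<And>X. X \<in> Met \<Longrightarrow> ob T X \<in> Met"
    and ar: "\<And>X Y f. X \<in> Met \<Longrightarrow> Y \<in> Met \<Longrightarrow> f \<in> nonexp X Y \<Longrightarrow>
      ar T X Y f \<in> nonexp (ob T X) (ob T Y)"
    and id: "\<And>X z. X \<in> Met \<Longrightarrow> z \<in> pts (ob T X) \<Longrightarrow> ar T X X (\<lambda>x\<in>pts X. x) z = z"
    and comp: "\<And>X Y Z f g z. X \<in> Met \<Longrightarrow> Y \<in> Met \<Longrightarrow> Z \<in> Met \<Longrightarrow> f \<in> nonexp X Y \<Longrightarrow>
      g \<in> nonexp Y Z \<Longrightarrow> z \<in> pts (ob T X) \<Longrightarrow>
      ar T X Z (compose (pts X) g f) z = ar T Y Z g (ar T X Y f z)"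
    and dist: "\<And>X Y f g z. X \<in> Met \<Longrightarrow> Y \<in> Met \<Longrightarrow> f \<in> nonexp X Y \<Longrightarrow> g \<in> nonexp X Y \<Longrightarrow>
      z \<in> pts (ob T X) \<Longrightarrow>
      dst (ob T Y) (ar T X Y f z) (ar T X Y g z) \<le> dst (hom_space X Y) f g"
  shows "enriched_endofunctor T"
proof -
  have I: "(\<lambda>x\<in>pts X. x) \<in> nonexp X X" for X :: "'u space"
    by (auto simp: nonexp_def)
  have 1: "ar T X X (\<lambda>x\<in>pts X. x) = (\<lambda>x\<in>pts (ob T X). x)" if "X \<in> Met" for X
    using id[OF that] by (intro nonexp_eqI[OF ar[OF that that I] I]) auto
  have 2: "ar T X Z (compose (pts X) g f) = compose (pts (ob T X)) (ar T Y Z g) (ar T X Y f)"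
    if "X \<in> Met" "Y \<in> Met" "Z \<in> Met" "f \<in> nonexp X Y" "g \<in> nonexp Y Z" for X Y Z f g
    using that comp[OF that]
    by (intro nonexp_eqI[where M = "ob T X" and N = "ob T Z"])
      (auto simp: compose_eq intro!: ar nonexp_compose)
  show ?thesis
    unfolding enriched_endofunctor_def using ob ar dist 1 2 by (simp add: dst_hom_space_le_iff)
qed

section \<open>Weighted cocones and the comparison map for a fixed pair of spaces\<close>

lemma mem_weighted_cocones:
  "\<phi> \<in> pts (weighted_cocones T X Y) \<longleftrightarrow>
     \<phi> \<in> (\<Pi>\<^sub>E S\<in>{S. finite S}.
        nonexp (hom_space (discrete S) X) (hom_space (ob T (discrete S)) Y)) \<and>
     (\<forall>S S'. finite S \<longrightarrow> finite S' \<longrightarrow>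
        (\<forall>f\<in>nonexp (discrete S) (discrete S'). \<forall>g\<in>nonexp (discrete S') X.
           \<phi> S (compose S g f) =
           compose (pts (ob T (discrete S))) (\<phi> S' g) (ar T (discrete S) (discrete S') f)))"
  by (simp add: weighted_cocones_def Let_def)

lemma dst_weighted_cocones:
  assumes "\<phi> \<in> pts (weighted_cocones T X Y)" "\<psi> \<in> pts (weighted_cocones T X Y)"
  shows "dst (weighted_cocones T X Y) \<phi> \<psi> =
    (SUP S\<in>{S. finite S}. dst (hom_space (hom_space (discrete S) X)
      (hom_space (ob T (discrete S)) Y)) (\<phi> S) (\<psi> S))"
  using assms by (simp add: weighted_cocones_def Let_def)

lemma pts_discrete [simp]: "pts (discrete S) = S"
  by (simp add: discrete_def)

context
  fixes T :: "'u endofunctor" and X Y :: "'u space"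
  assumes inf: "infinite (UNIV :: 'u set)"
    and T: "enriched_endofunctor T"
    and X: "X \<in> Met" and Y: "Y \<in> Met"
begin

lemma lan_comparison_nonexp:
  assumes "h \<in> nonexp (ob T X) Y" "finite S" "g \<in> nonexp (discrete S) X"
  shows "lan_comparison T X Y h S g \<in> nonexp (ob T (discrete S)) Y"
  using assms enriched_endofunctorD(2)[OF T discrete_in_Met[OF inf] X]
  by (auto simp: lan_comparison_def intro!: nonexp_compose)

lemma lan_comparison_apply:
  assumes "finite S" "g \<in> nonexp (discrete S) X" "t \<in> pts (ob T (discrete S))"
  shows "lan_comparison T X Y h S g t = h (ar T (discrete S) X g t)"
  using assms by (simp add: lan_comparison_def compose_def)

text \<open>Nonexpansion in \<open>g\<close> combines nonexpansion of \<open>h\<close> with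
  enrichment of \<open>T\<close>. Naturality is functoriality of \<open>T\<close> on the composite
  of \<open>g\<close> and \<open>f\<close>.\<close>

lemma lan_comparison_in_cocones:
  assumes h: "h \<in> nonexp (ob T X) Y"
  shows "lan_comparison T X Y h \<in> pts (weighted_cocones T X Y)"
proof -
  have 1: "lan_comparison T X Y h S \<in>
      nonexp (hom_space (discrete S) X) (hom_space (ob T (discrete S)) Y)"
    if S: "finite S" for S
  proof -
    have D: "discrete S \<in> Met"
      using inf S by (rule discrete_in_Met)
    have "dst Y (h (ar T (discrete S) X g t)) (h (ar T (discrete S) X g' t))
        \<le> dst (hom_space (discrete S) X) g g'"
      if g: "g \<in> nonexp (discrete S) X" "g' \<in> nonexp (discrete S) X"
        and t: "t \<in> pts (ob T (discrete S))" for g g' t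
    proof -
      note Tg = enriched_endofunctorD(2)[OF T D X g(1)] enriched_endofunctorD(2)[OF T D X g(2)]
      have "dst Y (h (ar T (discrete S) X g t)) (h (ar T (discrete S) X g' t))
          \<le> dst (ob T X) (ar T (discrete S) X g t) (ar T (discrete S) X g' t)"
        using nonexpD(3)[OF h] nonexpD(2)[OF Tg(1) t] nonexpD(2)[OF Tg(2) t] by blast
      also have "\<dots> \<le> dst (hom_space (ob T (discrete S)) (ob T X))
          (ar T (discrete S) X g) (ar T (discrete S) X g')"
        using Tg t by (rule dst_le_dst_hom_space)
      also have "\<dots> \<le> dst (hom_space (discrete S) X) g g'"
        using enriched_endofunctorD(4)[OF T D X g] .
      finally show ?thesis .
    qed
    moreover have "lan_comparison T X Y h S \<in> extensional (nonexp (discrete S) X)"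
      using S by (simp add: lan_comparison_def)
    ultimately show ?thesis
      using S lan_comparison_nonexp[OF h S]
      by (subst nonexp_def)
        (auto simp: PiE_iff dst_hom_space_le_iff lan_comparison_apply)
  qed
  have 2: "lan_comparison T X Y h S (compose S g f) =
      compose (pts (ob T (discrete S))) (lan_comparison T X Y h S' g)
        (ar T (discrete S) (discrete S') f)"
    if S: "finite S" "finite S'" and f: "f \<in> nonexp (discrete S) (discrete S')"
      and g: "g \<in> nonexp (discrete S') X" for S S' f g
  proof -
    note D = discrete_in_Met[OF inf S(1)] discrete_in_Met[OF inf S(2)]
    have gf: "compose S g f \<in> nonexp (discrete S) X"
      using nonexp_compose[OF f g] by simp
    have "ar T (discrete S) X (compose S g f) =
        compose (pts (ob T (discrete S))) (ar T (discrete S') X g)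
          (ar T (discrete S) (discrete S') f)"
      using enriched_endofunctorD(3)[OF T D X f g] by simp
    then show ?thesis
      using S g gf nonexpD(2)[OF enriched_endofunctorD(2)[OF T D f]]
      by (auto simp: lan_comparison_def compose_def intro!: ext)
  qed
  show ?thesis
    using 1 2 by (auto simp: mem_weighted_cocones PiE_iff lan_comparison_def)
qed

text \<open>The comparison map evaluates \<open>h\<close> at the elements
  \<open>ar T (discrete S) X g t\<close>. By \<open>gen\<close> these exhaust \<open>T X\<close>, so
  that both suprema run over the same distances and \<open>h\<close> can be recovered; this gives
  isometry and injectivity. By \<open>fact\<close> every cocone has such a form, which gives
  surjectivity.\<close>

lemma isometric_iso_lan_comparison:
  assumes gen: "\<And>z. z \<in> pts (ob T X) \<Longrightarrow> \<exists>S g. finite S \<and> g \<in> nonexp (discrete S) X \<and>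
      z \<in> ar T (discrete S) X g ` pts (ob T (discrete S))"
    and fact: "\<And>\<phi>. \<phi> \<in> pts (weighted_cocones T X Y) \<Longrightarrow> \<exists>h\<in>nonexp (ob T X) Y.
      \<forall>S. finite S \<longrightarrow> (\<forall>g\<in>nonexp (discrete S) X. \<forall>t\<in>pts (ob T (discrete S)).
        \<phi> S g t = h (ar T (discrete S) X g t))"
  shows "isometric_iso (lan_comparison T X Y) (hom_space (ob T X) Y) (weighted_cocones T X Y)"
proof -
  let ?L = "lan_comparison T X Y" and ?C = "weighted_cocones T X Y"
  have iso: "dst ?C (?L h) (?L k) = dst (hom_space (ob T X) Y) h k"
    if h: "h \<in> nonexp (ob T X) Y" and k: "k \<in> nonexp (ob T X) Y" for h k
  proof -
    \<comment> \<open>The two distances are compared through their upper bounds \<open>c\<close>,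
      which turns the nested suprema into pointwise conditions. Choosing each distance in turn as
      \<open>c\<close> then yields equality.\<close>
    have le_iff: "dst ?C (?L h) (?L k) \<le> c \<longleftrightarrow> dst (hom_space (ob T X) Y) h k \<le> c" for c
    proof -
      have "dst ?C (?L h) (?L k) \<le> c \<longleftrightarrow> (\<forall>S. finite S \<longrightarrow>
          dst (hom_space (hom_space (discrete S) X) (hom_space (ob T (discrete S)) Y))
            (?L h S) (?L k S) \<le> c)"
        using h k by (simp add: dst_weighted_cocones lan_comparison_in_cocones SUP_le_iff)
      also have "\<dots> \<longleftrightarrow> (\<forall>S. finite S \<longrightarrow> (\<forall>g\<in>nonexp (discrete S) X.
          \<forall>t\<in>pts (ob T (discrete S)).
            dst Y (h (ar T (discrete S) X g t)) (k (ar T (discrete S) X g t)) \<le> c))"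
      proof (intro all_cong1 imp_cong refl)
        fix S :: "'u set" assume S: "finite S"
        have "?L m S \<in> nonexp (hom_space (discrete S) X) (hom_space (ob T (discrete S)) Y)"
          if "m \<in> nonexp (ob T X) Y" for m
          using lan_comparison_in_cocones[OF that] S by (auto simp: mem_weighted_cocones)
        then show "dst (hom_space (hom_space (discrete S) X) (hom_space (ob T (discrete S)) Y))
            (?L h S) (?L k S) \<le> c \<longleftrightarrow> (\<forall>g\<in>nonexp (discrete S) X.
          \<forall>t\<in>pts (ob T (discrete S)).
            dst Y (h (ar T (discrete S) X g t)) (k (ar T (discrete S) X g t)) \<le> c)"
          using h k S lan_comparison_nonexp
          by (simp add: dst_hom_space_le_iff lan_comparison_apply)
      qed
      also have "\<dots> \<longleftrightarrow> (\<forall>z\<in>pts (ob T X). dst Y (h z) (k z) \<le> c)"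
      proof (intro iffI ballI allI impI)
        fix z assume *: "\<forall>S. finite S \<longrightarrow> (\<forall>g\<in>nonexp (discrete S) X.
          \<forall>t\<in>pts (ob T (discrete S)).
            dst Y (h (ar T (discrete S) X g t)) (k (ar T (discrete S) X g t)) \<le> c)"
          and "z \<in> pts (ob T X)"
        then show "dst Y (h z) (k z) \<le> c"
          using gen[of z] by blast
      next
        fix S g t assume *: "\<forall>z\<in>pts (ob T X). dst Y (h z) (k z) \<le> c" "finite S"
          "g \<in> nonexp (discrete S) X" "t \<in> pts (ob T (discrete S))"
        then show "dst Y (h (ar T (discrete S) X g t)) (k (ar T (discrete S) X g t)) \<le> c"
          using nonexpD(2)[OF enriched_endofunctorD(2)[OF T discrete_in_Met[OF inf] X]] by blast
      qed
      finally show ?thesis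
        using h k by (simp add: dst_hom_space_le_iff)
    qed
    show ?thesis
      by (rule antisym) (simp_all add: le_iff, simp flip: le_iff)
  qed
  have "inj_on ?L (nonexp (ob T X) Y)"
  proof (rule inj_onI)
    fix h k assume h: "h \<in> nonexp (ob T X) Y" and k: "k \<in> nonexp (ob T X) Y"
      and eq: "?L h = ?L k"
    show "h = k"
    proof (rule nonexp_eqI[OF h k])
      fix z assume "z \<in> pts (ob T X)"
      then obtain S g t where "finite S" "g \<in> nonexp (discrete S) X"
        "t \<in> pts (ob T (discrete S))" "z = ar T (discrete S) X g t"
        using gen by blast
      then show "h z = k z"
        using lan_comparison_apply eq by metis
    qed
  qed
  moreover have "\<phi> \<in> ?L ` nonexp (ob T X) Y" if \<phi>: "\<phi> \<in> pts ?C" for \<phi>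
  proof -
    obtain h where h: "h \<in> nonexp (ob T X) Y" and
      eq: "\<And>S g t. finite S \<Longrightarrow> g \<in> nonexp (discrete S) X \<Longrightarrow> t \<in> pts (ob T (discrete S)) \<Longrightarrow>
        \<phi> S g t = h (ar T (discrete S) X g t)"
      using fact[OF \<phi>] by blast
    have in_hom: "\<psi> S \<in> nonexp (hom_space (discrete S) X) (hom_space (ob T (discrete S)) Y)"
      if "\<psi> \<in> pts ?C" "finite S" for \<psi> S
      using that by (auto simp: mem_weighted_cocones)
    note L = lan_comparison_in_cocones[OF h]
    \<comment> \<open>Agreement at elements \<open>t\<close> is lifted by extensionality in stages:
      to maps on \<open>ob T (discrete S)\<close>, then to functions of \<open>g\<close>, then to
      families indexed by \<open>S\<close>.\<close>
    have "\<phi> S g = ?L h S g" if "finite S" "g \<in> nonexp (discrete S) X" for S g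
      using that nonexpD(2)[OF in_hom[OF \<phi>]] nonexpD(2)[OF in_hom[OF L]]
      by (intro nonexp_eqI[where M = "ob T (discrete S)" and N = Y])
        (auto simp: eq lan_comparison_apply)
    then have "\<phi> S = ?L h S" if "finite S" for S
      using that in_hom[OF \<phi>] in_hom[OF L]
      by (intro nonexp_eqI[where M = "hom_space (discrete S) X"]) auto
    then have "\<phi> = ?L h"
      using \<phi> L by (intro PiE_ext[of _ "{S. finite S}"]) (auto simp: mem_weighted_cocones)
    then show ?thesis
      using h by blast
  qed
  ultimately show ?thesis
    using iso lan_comparison_in_cocones by (auto simp: isometric_iso_def bij_betw_def)
qed

end


section \<open>The criterion for all spaces, and tools for applying it\<close>

lemma strongly_finitaryI:
  fixes T :: "'u endofunctor"
  assumes "infinite (UNIV :: 'u set)" "enriched_endofunctor T"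
    and "\<And>X z. X \<in> Met \<Longrightarrow> z \<in> pts (ob T X) \<Longrightarrow> \<exists>S g. finite S \<and>
      g \<in> nonexp (discrete S) X \<and> z \<in> ar T (discrete S) X g ` pts (ob T (discrete S))"
    and "\<And>X Y \<phi>. X \<in> Met \<Longrightarrow> Y \<in> Met \<Longrightarrow> \<phi> \<in> pts (weighted_cocones T X Y) \<Longrightarrow>
      \<exists>h\<in>nonexp (ob T X) Y. \<forall>S. finite S \<longrightarrow>
        (\<forall>g\<in>nonexp (discrete S) X. \<forall>t\<in>pts (ob T (discrete S)).
          \<phi> S g t = h (ar T (discrete S) X g t))"
  shows "strongly_finitary T"
  unfolding strongly_finitary_def using assms
  by (intro conjI ballI isometric_iso_lan_comparison) blast+

text \<open>Evaluation at an element \<open>t\<close> turns naturality into an equation between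
  points of \<open>Y\<close>, and nonexpansion of \<open>\<phi> S\<close> into an inequality for
  varying \<open>g\<close> and fixed \<open>t\<close>. In this form the generic-element arguments
  can use them.\<close>

lemma weighted_coconeD:
  assumes "\<phi> \<in> pts (weighted_cocones T X Y)" "finite S"
  shows "\<phi> S \<in> nonexp (hom_space (discrete S) X) (hom_space (ob T (discrete S)) Y)"
    and "g \<in> nonexp (discrete S) X \<Longrightarrow> \<phi> S g \<in> nonexp (ob T (discrete S)) Y"
    and "finite S' \<Longrightarrow> f \<in> nonexp (discrete S) (discrete S') \<Longrightarrow> g \<in> nonexp (discrete S') X \<Longrightarrow>
      t \<in> pts (ob T (discrete S)) \<Longrightarrow>
      \<phi> S (compose S g f) t = \<phi> S' g (ar T (discrete S) (discrete S') f t)"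
    and "g \<in> nonexp (discrete S) X \<Longrightarrow> g' \<in> nonexp (discrete S) X \<Longrightarrow>
      t \<in> pts (ob T (discrete S)) \<Longrightarrow>
      dst Y (\<phi> S g t) (\<phi> S g' t) \<le> dst (hom_space (discrete S) X) g g'"
proof -
  show 1: "\<phi> S \<in> nonexp (hom_space (discrete S) X) (hom_space (ob T (discrete S)) Y)"
    using assms by (auto simp: mem_weighted_cocones)
  show 2: "g \<in> nonexp (discrete S) X \<Longrightarrow> \<phi> S g \<in> nonexp (ob T (discrete S)) Y" for g
    using nonexpD(2)[OF 1] by simp
  show "\<phi> S (compose S g f) t = \<phi> S' g (ar T (discrete S) (discrete S') f t)"
    if "finite S'" "f \<in> nonexp (discrete S) (discrete S')" "g \<in> nonexp (discrete S') X"
      "t \<in> pts (ob T (discrete S))"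
    using assms that by (simp add: mem_weighted_cocones compose_def)
  show "dst Y (\<phi> S g t) (\<phi> S g' t) \<le> dst (hom_space (discrete S) X) g g'"
    if "g \<in> nonexp (discrete S) X" "g' \<in> nonexp (discrete S) X"
      "t \<in> pts (ob T (discrete S))"
    using dst_le_dst_hom_space[OF 2[OF that(1)] 2[OF that(2)] that(3)]
      nonexpD(3)[OF 1, of g g'] that(1,2) by simp
qed

text \<open>Distinct points of a discrete space are infinitely far apart, and equal points have
  images at distance zero.\<close>

lemma nonexp_discreteI:
  assumes "\<And>s. s \<in> S \<Longrightarrow> g s \<in> pts X" "X \<in> Met"
  shows "(\<lambda>s\<in>S. g s) \<in> nonexp (discrete S) X"
  using assms Met_dst_eq_0[OF assms(2)] by (auto simp: nonexp_def discrete_def)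

text \<open>If one factor is infinite, the product embeds into the square of the larger factor,
  which is equipotent to that factor. Otherwise the product is finite.\<close>

lemma lesspoll_infinite_times:
  fixes A B :: "'u set"
  assumes "infinite (UNIV :: 'u set)" "A \<prec> (UNIV :: 'u set)" "B \<prec> (UNIV :: 'u set)"
  shows "A \<times> B \<prec> (UNIV :: 'u set)"
proof (cases "finite A \<and> finite B")
  case True
  then show ?thesis
    using assms(1) by (simp add: finite_lesspoll_infinite)
next
  case False
  have "A \<lesssim> B \<or> B \<lesssim> A"
    using ordLeq_total[OF card_of_Well_order card_of_Well_order, of A B]
    by (simp add: lepoll_def flip: card_of_ordLeq)
  then obtain C where C: "C \<in> {A, B}" "A \<lesssim> C" "B \<lesssim> C"
    using lepoll_refl by blast
  then have "infinite C"
    using False finite_lepoll_infinite lepoll_def finite_subset finite_imageD by metis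
  then have "C \<times> C \<approx> C"
    by (simp add: card_of_Times_same_infinite eqpoll_iff_card_of_ordIso)
  moreover have "A \<times> B \<lesssim> C \<times> C"
    using C(2,3) by (rule times_lepoll_mono)
  ultimately show ?thesis
    using C(1) assms(2,3) by (metis insert_iff lepoll_trans2 lesspoll_trans1 singletonD)
qed

section \<open>Tensor products and squares\<close>

text \<open>Endofunctors live on spaces with points in one type \<open>'u\<close>, so products have
  to be coded inside \<open>'u\<close>. A bijection of \<open>'u \<times> 'u\<close> with
  \<open>'u\<close> serves this purpose.\<close>

locale pairing =
  fixes pair :: "'u \<Rightarrow> 'u \<Rightarrow> 'u" and pr1 pr2 :: "'u \<Rightarrow> 'u"
  assumes infinite_UNIV: "infinite (UNIV :: 'u set)"
    and pr1_pair [simp]: "pr1 (pair x y) = x"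
    and pr2_pair [simp]: "pr2 (pair x y) = y"
    and pair_pr [simp]: "pair (pr1 z) (pr2 z) = z"
begin

lemma pr_eqI: "pr1 z = pr1 w \<Longrightarrow> pr2 z = pr2 w \<Longrightarrow> z = w"
  by (metis pair_pr)

definition tensor_pts :: "'u set \<Rightarrow> 'u set \<Rightarrow> 'u set" where
  "tensor_pts A B = {z. pr1 z \<in> A \<and> pr2 z \<in> B}"

lemma tensor_pts_lesspoll:
  assumes "A \<prec> (UNIV :: 'u set)" "B \<prec> (UNIV :: 'u set)"
  shows "tensor_pts A B \<prec> (UNIV :: 'u set)"
proof -
  have "tensor_pts A B \<lesssim> A \<times> B"
    unfolding lepoll_def
    by (rule exI[of _ "\<lambda>z. (pr1 z, pr2 z)"]) (auto simp: tensor_pts_def inj_on_def intro: pr_eqI)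
  then show ?thesis
    using lesspoll_infinite_times[OF infinite_UNIV assms] lesspoll_trans1 by blast
qed

definition tensor :: "'u space \<Rightarrow> 'u endofunctor" where
  "tensor A =
     \<lparr>ob = (\<lambda>X. \<lparr>pts = tensor_pts (pts A) (pts X),
        dst = (\<lambda>z w. if z \<in> tensor_pts (pts A) (pts X) \<and> w \<in> tensor_pts (pts A) (pts X)
          then dst A (pr1 z) (pr1 w) + dst X (pr2 z) (pr2 w) else 0)\<rparr>),
      ar = (\<lambda>X Y f. \<lambda>z\<in>tensor_pts (pts A) (pts X). pair (pr1 z) (f (pr2 z)))\<rparr>"

text \<open>Up to isomorphism this is the hom-space out of a two-point discrete space, since the
  maximum is the supremum metric on such maps.\<close>

definition square :: "'u endofunctor" where
  "square =
     \<lparr>ob = (\<lambda>X. \<lparr>pts = tensor_pts (pts X) (pts X),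
        dst = (\<lambda>z w. if z \<in> tensor_pts (pts X) (pts X) \<and> w \<in> tensor_pts (pts X) (pts X)
          then max (dst X (pr1 z) (pr1 w)) (dst X (pr2 z) (pr2 w)) else 0)\<rparr>),
      ar = (\<lambda>X Y f. \<lambda>z\<in>tensor_pts (pts X) (pts X). pair (f (pr1 z)) (f (pr2 z)))\<rparr>"

lemma tensor_simps [simp]:
  "pts (ob (tensor A) X) = tensor_pts (pts A) (pts X)"
  "dst (ob (tensor A) X) z w =
     (if z \<in> tensor_pts (pts A) (pts X) \<and> w \<in> tensor_pts (pts A) (pts X)
      then dst A (pr1 z) (pr1 w) + dst X (pr2 z) (pr2 w) else 0)"
  "ar (tensor A) X Y f = (\<lambda>z\<in>tensor_pts (pts A) (pts X). pair (pr1 z) (f (pr2 z)))"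
  by (simp_all add: tensor_def)

lemma square_simps [simp]:
  "pts (ob square X) = tensor_pts (pts X) (pts X)"
  "dst (ob square X) z w =
     (if z \<in> tensor_pts (pts X) (pts X) \<and> w \<in> tensor_pts (pts X) (pts X)
      then max (dst X (pr1 z) (pr1 w)) (dst X (pr2 z) (pr2 w)) else 0)"
  "ar square X Y f = (\<lambda>z\<in>tensor_pts (pts X) (pts X). pair (f (pr1 z)) (f (pr2 z)))"
  by (simp_all add: square_def)

lemma mem_tensor_pts [simp]: "z \<in> tensor_pts A B \<longleftrightarrow> pr1 z \<in> A \<and> pr2 z \<in> B"
  by (simp add: tensor_pts_def)

lemma tensor_in_Met:
  assumes A: "A \<in> Met" and X: "X \<in> Met"
  shows "ob (tensor A) X \<in> Met"
proof -
  have "pts (ob (tensor A) X) \<prec> (UNIV :: 'u set)"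
    using assms by (simp add: tensor_pts_lesspoll Met_def)
  moreover have "ext_metric_space (ob (tensor A) X)"
    unfolding ext_metric_space_def
  proof (intro conjI ballI)
    fix x y z assume "x \<in> pts (ob (tensor A) X)" "y \<in> pts (ob (tensor A) X)"
      "z \<in> pts (ob (tensor A) X)"
    then show "dst (ob (tensor A) X) x z \<le> dst (ob (tensor A) X) x y + dst (ob (tensor A) X) y z"
      using add_mono[OF Met_triangle[OF A, of "pr1 x" "pr1 y" "pr1 z"]
          Met_triangle[OF X, of "pr2 x" "pr2 y" "pr2 z"]]
      by (simp add: ac_simps)
  qed (auto simp: Met_dst_eq_0[OF A] Met_dst_eq_0[OF X] Met_sym[OF A] Met_sym[OF X] intro: pr_eqI)
  ultimately show ?thesis
    by (simp add: Met_def)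
qed

lemma square_in_Met:
  assumes X: "X \<in> Met"
  shows "ob square X \<in> Met"
proof -
  have "pts (ob square X) \<prec> (UNIV :: 'u set)"
    using assms by (simp add: tensor_pts_lesspoll Met_def)
  moreover have "ext_metric_space (ob square X)"
    unfolding ext_metric_space_def
  proof (intro conjI ballI)
    fix x y assume "x \<in> pts (ob square X)" "y \<in> pts (ob square X)"
    moreover have "max a b = 0 \<longleftrightarrow> a = 0 \<and> b = 0" for a b :: ennreal
      by (auto simp: max_def)
    ultimately show "dst (ob square X) x y = 0 \<longleftrightarrow> x = y"
      by (auto simp: Met_dst_eq_0[OF X] intro: pr_eqI)
  next
    fix x y z assume "x \<in> pts (ob square X)" "y \<in> pts (ob square X)" "z \<in> pts (ob square X)"
    then show "dst (ob square X) x z \<le> dst (ob square X) x y + dst (ob square X) y z"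
      \<comment> \<open>The triangle inequality holds in each coordinate, and each of its two
        summands is at most the corresponding maximum.\<close>
      using order_trans[OF Met_triangle[OF X, of "pr1 x" "pr1 y" "pr1 z"] add_mono]
        order_trans[OF Met_triangle[OF X, of "pr2 x" "pr2 y" "pr2 z"] add_mono]
      by simp
  qed (auto simp: Met_sym[OF X])
  ultimately show ?thesis
    by (simp add: Met_def)
qed

lemma enriched_endofunctor_tensor:
  assumes A: "A \<in> Met"
  shows "enriched_endofunctor (tensor A)"
proof (rule enriched_endofunctorI)
  fix X Y :: "'u space" and f assume f: "f \<in> nonexp X Y"
  show "ar (tensor A) X Y f \<in> nonexp (ob (tensor A) X) (ob (tensor A) Y)"
    using nonexpD(2,3)[OF f] by (subst nonexp_def) (auto intro!: add_left_mono)
  fix g z assume g: "g \<in> nonexp X Y" and z: "z \<in> pts (ob (tensor A) X)"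
  \<comment> \<open>Both images of \<open>z\<close> keep its first coordinate, so only the second
    summand of the metric remains.\<close>
  have "dst A (pr1 z) (pr1 z) = 0"
    using z Met_dst_eq_0[OF A] by simp
  then show "dst (ob (tensor A) Y) (ar (tensor A) X Y f z) (ar (tensor A) X Y g z)
      \<le> dst (hom_space X Y) f g"
    using z dst_le_dst_hom_space[OF f g] nonexpD(2)[OF f] nonexpD(2)[OF g] by simp
next
  fix X Y Z :: "'u space" and f g z assume "f \<in> nonexp X Y" "z \<in> pts (ob (tensor A) X)"
  then show "ar (tensor A) X Z (compose (pts X) g f) z =
      ar (tensor A) Y Z g (ar (tensor A) X Y f z)"
    using nonexpD(2)[of f X Y] by (simp add: compose_eq)
qed (use tensor_in_Met[OF A] in auto)

lemma enriched_endofunctor_square: "enriched_endofunctor square"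
proof (rule enriched_endofunctorI)
  fix X Y :: "'u space" and f assume f: "f \<in> nonexp X Y"
  show "ar square X Y f \<in> nonexp (ob square X) (ob square Y)"
    using nonexpD(2,3)[OF f] by (subst nonexp_def) (auto intro!: max.mono simp del: max.bounded_iff)
  fix g z assume g: "g \<in> nonexp X Y" and z: "z \<in> pts (ob square X)"
  then show "dst (ob square Y) (ar square X Y f z) (ar square X Y g z)
      \<le> dst (hom_space X Y) f g"
    using dst_le_dst_hom_space[OF f g] nonexpD(2)[OF f] nonexpD(2)[OF g] by simp
next
  fix X Y Z :: "'u space" and f g z assume "f \<in> nonexp X Y" "z \<in> pts (ob square X)"
  then show "ar square X Z (compose (pts X) g f) z = ar square Y Z g (ar square X Y f z)"
    using nonexpD(2)[of f X Y] by (simp add: compose_eq)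
qed (use square_in_Met in auto)

text \<open>Each element lies over the single point \<open>pr2 z\<close>, so singletons generate. By
  naturality along maps out of a singleton \<open>{e}\<close>, a cocone is determined by its values
  at the pairs of \<open>a\<close> and \<open>e\<close>, with \<open>a\<close> in \<open>A\<close>;
  these values define the factorisation \<open>h\<close>.\<close>

lemma strongly_finitary_tensor:
  assumes A: "A \<in> Met"
  shows "strongly_finitary (tensor A)"
proof (rule strongly_finitaryI[OF infinite_UNIV enriched_endofunctor_tensor[OF A]])
  fix X z assume X: "X \<in> Met" and z: "z \<in> pts (ob (tensor A) X)"
  have "(\<lambda>s\<in>{pr2 z}. s) \<in> nonexp (discrete {pr2 z}) X"
    using z X by (intro nonexp_discreteI) auto
  moreover have "z = ar (tensor A) (discrete {pr2 z}) X (\<lambda>s\<in>{pr2 z}. s) z"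
    using z by simp
  ultimately show "\<exists>S g. finite S \<and> g \<in> nonexp (discrete S) X \<and>
      z \<in> ar (tensor A) (discrete S) X g ` pts (ob (tensor A) (discrete S))"
    using z by (intro exI[of _ "{pr2 z}"] exI[of _ "\<lambda>s\<in>{pr2 z}. s"] conjI image_eqI[of _ _ z]) auto
next
  fix X Y \<phi> assume X: "X \<in> Met" and Y: "Y \<in> Met"
    and \<phi>: "\<phi> \<in> pts (weighted_cocones (tensor A) X Y)"
  define e :: 'u where "e = undefined"
  define c where "c x = (\<lambda>s\<in>{e}. x)" for x :: 'u
  define h where "h = (\<lambda>z\<in>pts (ob (tensor A) X). \<phi> {e} (c (pr2 z)) (pair (pr1 z) e))"
  note D = weighted_coconeD[OF \<phi>, of "{e}", simplified]
  have c: "c x \<in> nonexp (discrete {e}) X" if "x \<in> pts X" for x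
    unfolding c_def using that X by (intro nonexp_discreteI)
  have h: "h \<in> nonexp (ob (tensor A) X) Y"
    unfolding nonexp_def
  proof (intro CollectI conjI ballI)
    show "h \<in> pts (ob (tensor A) X) \<rightarrow>\<^sub>E pts Y"
      using nonexpD(2)[OF D(2)[OF c]] by (auto simp: h_def)
  next
    fix z w assume z: "z \<in> pts (ob (tensor A) X)" and w: "w \<in> pts (ob (tensor A) X)"
    \<comment> \<open>The intermediate point separates the two coordinates. From \<open>h z\<close>
      to \<open>?m\<close> only the element of \<open>A\<close> changes, which costs a distance in
      \<open>A\<close>; from \<open>?m\<close> to \<open>h w\<close> only the map into
      \<open>X\<close> changes, which costs a distance in \<open>X\<close>. The triangle inequality
      produces exactly the sum metric.\<close>
    let ?m = "\<phi> {e} (c (pr2 z)) (pair (pr1 w) e)"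
    have m: "h z \<in> pts Y" "?m \<in> pts Y" "h w \<in> pts Y"
      using z w nonexpD(2)[OF D(2)[OF c]] by (auto simp: h_def)
    have "dst Y (h z) ?m \<le> dst A (pr1 z) (pr1 w)"
      using nonexpD(3)[OF D(2)[OF c], of "pr2 z" "pair (pr1 z) e" "pair (pr1 w) e"] z w
      by (simp add: h_def discrete_def)
    moreover have "dst Y ?m (h w) \<le> dst (hom_space (discrete {e}) X) (c (pr2 z)) (c (pr2 w))"
      using D(4)[OF c c, of "pr2 z" "pr2 w" "pair (pr1 w) e"] z w by (simp add: h_def)
    moreover have "\<dots> \<le> dst X (pr2 z) (pr2 w)"
      using z w by (subst dst_hom_space_le_iff[OF c c]) (auto simp: c_def)
    ultimately have "dst Y (h z) (h w) \<le> dst A (pr1 z) (pr1 w) + dst X (pr2 z) (pr2 w)"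
      using Met_triangle[OF Y m] by (meson add_mono order_trans)
    then show "dst Y (h z) (h w) \<le> dst (ob (tensor A) X) z w"
      using z w by simp
  qed
  moreover have "\<phi> S g t = h (ar (tensor A) (discrete S) X g t)"
    if S: "finite S" and g: "g \<in> nonexp (discrete S) X"
      and t: "t \<in> pts (ob (tensor A) (discrete S))" for S g t
  proof -
    \<comment> \<open>This map carries the generic pair of \<open>pr1 t\<close> and \<open>e\<close>
      to \<open>t\<close>, so naturality reduces \<open>\<phi> S g t\<close> to a value over
      \<open>{e}\<close>.\<close>
    have f: "(\<lambda>s\<in>{e}. pr2 t) \<in> nonexp (discrete {e}) (discrete S)"
      using t discrete_in_Met[OF infinite_UNIV S] by (intro nonexp_discreteI) auto
    have "compose {e} g (\<lambda>s\<in>{e}. pr2 t) = c (g (pr2 t))"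
      by (auto simp: compose_def c_def)
    then show ?thesis
      using D(3)[OF S f g, of "pair (pr1 t) e"] t nonexpD(2)[OF g]
      by (simp add: h_def)
  qed
  ultimately show "\<exists>h\<in>nonexp (ob (tensor A) X) Y. \<forall>S. finite S \<longrightarrow>
      (\<forall>g\<in>nonexp (discrete S) X. \<forall>t\<in>pts (ob (tensor A) (discrete S)).
        \<phi> S g t = h (ar (tensor A) (discrete S) X g t))"
    by blast
qed

text \<open>Every element is the image of the generic pair \<open>pair a b\<close> over a
  two-element set, so a cocone is determined by its values there. Since only the map into
  \<open>X\<close> varies, the bound obtained is the supremum metric on maps from
  \<open>{a, b}\<close>, which is the maximum metric; no intermediate point is required.\<close>

lemma strongly_finitary_square: "strongly_finitary square"
proof (rule strongly_finitaryI[OF infinite_UNIV enriched_endofunctor_square])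
  fix X z assume X: "X \<in> Met" and z: "z \<in> pts (ob square X)"
  let ?S = "{pr1 z, pr2 z}"
  have "(\<lambda>s\<in>?S. s) \<in> nonexp (discrete ?S) X"
    using z X by (intro nonexp_discreteI) auto
  moreover have "z = ar square (discrete ?S) X (\<lambda>s\<in>?S. s) z"
    using z by simp
  ultimately show "\<exists>S g. finite S \<and> g \<in> nonexp (discrete S) X \<and>
      z \<in> ar square (discrete S) X g ` pts (ob square (discrete S))"
    using z by (intro exI[of _ ?S] exI[of _ "\<lambda>s\<in>?S. s"] conjI image_eqI[of _ _ z]) auto
next
  fix X Y \<phi> assume X: "X \<in> Met" and Y: "Y \<in> Met"
    and \<phi>: "\<phi> \<in> pts (weighted_cocones square X Y)"
  obtain a b :: 'u where ab: "a \<noteq> b"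
    using infinite_UNIV by (metis (full_types) finite.simps UNIV_I finite_subset subsetI singletonI)
  \<comment> \<open>As \<open>a\<close> and \<open>b\<close> differ, this map sends the generic pair
    to the arbitrary pair \<open>x\<close>, \<open>y\<close>.\<close>
  define c where "c x y = (\<lambda>s\<in>{a, b}. if s = a then x else y)" for x y :: 'u
  define h where "h = (\<lambda>z\<in>pts (ob square X). \<phi> {a, b} (c (pr1 z) (pr2 z)) (pair a b))"
  note D = weighted_coconeD[OF \<phi>, of "{a, b}", simplified]
  have c: "c x y \<in> nonexp (discrete {a, b}) X" if "x \<in> pts X" "y \<in> pts X" for x y
    unfolding c_def using that X by (intro nonexp_discreteI) auto
  have h: "h \<in> nonexp (ob square X) Y"
    unfolding nonexp_def
  proof (intro CollectI conjI ballI)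
    show "h \<in> pts (ob square X) \<rightarrow>\<^sub>E pts Y"
      using nonexpD(2)[OF D(2)[OF c]] by (auto simp: h_def)
  next
    fix z w assume z: "z \<in> pts (ob square X)" and w: "w \<in> pts (ob square X)"
    have "dst Y (h z) (h w) \<le>
        dst (hom_space (discrete {a, b}) X) (c (pr1 z) (pr2 z)) (c (pr1 w) (pr2 w))"
      using D(4)[OF c c, of "pr1 z" "pr2 z" "pr1 w" "pr2 w" "pair a b"] z w
      by (simp add: h_def)
    also have "\<dots> \<le> dst (ob square X) z w"
      using z w by (subst dst_hom_space_le_iff[OF c c]) (auto simp: c_def)
    finally show "dst Y (h z) (h w) \<le> dst (ob square X) z w" .
  qed
  moreover have "\<phi> S g t = h (ar square (discrete S) X g t)"
    if S: "finite S" and g: "g \<in> nonexp (discrete S) X"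
      and t: "t \<in> pts (ob square (discrete S))" for S g t
  proof -
    \<comment> \<open>Under this map the generic pair goes to \<open>t\<close>, and naturality along
      it identifies \<open>\<phi> S g t\<close> with the value of \<open>h\<close>.\<close>
    let ?f = "\<lambda>s\<in>{a, b}. if s = a then pr1 t else pr2 t"
    have f: "?f \<in> nonexp (discrete {a, b}) (discrete S)"
      using t discrete_in_Met[OF infinite_UNIV S] by (intro nonexp_discreteI) auto
    have "compose {a, b} g ?f = c (g (pr1 t)) (g (pr2 t))"
      by (auto simp: compose_def c_def)
    then show ?thesis
      using D(3)[OF S f g, of "pair a b"] t nonexpD(2)[OF g] ab
      by (simp add: h_def)
  qed
  ultimately show "\<exists>h\<in>nonexp (ob square X) Y. \<forall>S. finite S \<longrightarrow>
      (\<forall>g\<in>nonexp (discrete S) X. \<forall>t\<in>pts (ob square (discrete S)).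
        \<phi> S g t = h (ar square (discrete S) X g t))"
    by blast
qed

end

lemma ex_pairing:
  assumes "infinite (UNIV :: 'u set)"
  shows "\<exists>(pair :: 'u \<Rightarrow> 'u \<Rightarrow> 'u) pr1 pr2. pairing pair pr1 pr2"
proof -
  obtain p :: "'u \<times> 'u \<Rightarrow> 'u" where p: "bij p"
    using card_of_Times_same_infinite[OF assms] card_of_ordIso[of "UNIV \<times> UNIV"]
    by (metis UNIV_Times_UNIV)
  have "pairing (\<lambda>x y. p (x, y)) (\<lambda>z. fst (inv p z)) (\<lambda>z. snd (inv p z))"
    using assms p by unfold_locales (simp_all add: bij_is_inj bij_is_surj surj_f_inv_f)
  then show ?thesis
    by blast
qed

section \<open>The composite\<close>

text \<open>The integer segment from 0 to \<open>n\<close>, transported into \<open>'u\<close> along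
  an injection \<open>u\<close>; \<open>inv u\<close> reads off the coordinate. The case
  \<open>n = 1\<close> supplies both the tensor factor and the test object, and \<open>n = 2\<close>
  the target, which has room for a sum of two coordinates.\<close>

definition line :: "(nat \<Rightarrow> 'u) \<Rightarrow> nat \<Rightarrow> 'u space" where
  "line u n =
     \<lparr>pts = u ` {..n},
      dst = (\<lambda>x y. if x \<in> u ` {..n} \<and> y \<in> u ` {..n}
        then ennreal \<bar>real (inv u x) - real (inv u y)\<bar> else 0)\<rparr>"

lemma pts_line [simp]: "pts (line u n) = u ` {..n}"
  by (simp add: line_def)

lemma dst_line [simp]:
  assumes "inj u" "i \<le> n" "j \<le> n"
  shows "dst (line u n) (u i) (u j) = ennreal \<bar>real i - real j\<bar>"
  using assms by (simp add: line_def)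

lemma line_in_Met:
  fixes u :: "nat \<Rightarrow> 'u"
  assumes u: "inj u"
  shows "line u n \<in> Met"
proof -
  have "infinite (UNIV :: 'u set)"
    using u by (auto simp: infinite_iff_countable_subset)
  then have "u ` {..n} \<prec> (UNIV :: 'u set)"
    by (simp add: finite_lesspoll_infinite)
  moreover have "ext_metric_space (line u n)"
    unfolding ext_metric_space_def
  proof (intro conjI ballI)
    fix x y z assume "x \<in> pts (line u n)" "y \<in> pts (line u n)" "z \<in> pts (line u n)"
    then show "dst (line u n) x z \<le> dst (line u n) x y + dst (line u n) y z"
      using u by (auto simp flip: ennreal_plus intro!: ennreal_leI)
  qed (use u in \<open>auto simp: line_def ennreal_eq_0_iff abs_minus_commute\<close>)
  ultimately show ?thesis
    by (simp add: Met_def)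
qed

text \<open>The family \<open>\<phi>\<close> given by adding the first \<open>A\<close>-coordinate
  to the second \<open>X\<close>-coordinate is a cocone. A factorisation through \<open>T X\<close>
  would have to be this sum, which sends two points at distance 1 to points at distance 2.\<close>

lemma (in pairing) not_strongly_finitary_square_tensor:
  fixes u :: "nat \<Rightarrow> 'u"
  assumes u: "inj u"
  shows "\<not> strongly_finitary (square \<cdot> tensor (line u 1))"
proof
  define T where "T = square \<cdot> tensor (line u 1)"
  let ?X = "line u 1" and ?Y = "line u 2"
  assume "strongly_finitary (square \<cdot> tensor (line u 1))"
  then have "isometric_iso (lan_comparison T ?X ?Y) (hom_space (ob T ?X) ?Y)
      (weighted_cocones T ?X ?Y)"
    using line_in_Met[OF u] by (simp add: strongly_finitary_def T_def)
  then have surj: "lan_comparison T ?X ?Y ` nonexp (ob T ?X) ?Y = pts (weighted_cocones T ?X ?Y)"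
    by (simp add: isometric_iso_def bij_betw_def)
  have ob: "ob T Z = ob square (ob (tensor ?X) Z)" for Z
    by (simp add: T_def comp_endofunctor_def)
  have ar: "ar T Z W f = ar square (ob (tensor ?X) Z) (ob (tensor ?X) W) (ar (tensor ?X) Z W f)"
    for Z W f
    by (simp add: T_def comp_endofunctor_def)
  \<comment> \<open>An element \<open>z\<close> codes a pair of pairs
    \<open>((a, s), (b, t))\<close> with \<open>s\<close>, \<open>t\<close> in the finite set; the
    value is the sum of the coordinates of \<open>a\<close> and \<open>g t\<close>.\<close>
  define val where "val g z = u (inv u (pr1 (pr1 z)) + inv u (g (pr2 (pr2 z))))"
    for g :: "'u \<Rightarrow> 'u" and z
  define \<phi> where "\<phi> = (\<lambda>S\<in>{S :: 'u set. finite S}. \<lambda>g\<in>nonexp (discrete S) ?X.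
    \<lambda>z\<in>pts (ob T (discrete S)). val g z)"
  have inv_le: "inv u x \<le> 1" "u (inv u x) = x" if "x \<in> pts ?X" for x
    using that u by auto
  have val: "val g z \<in> pts ?Y" if "g \<in> nonexp (discrete S) ?X" "z \<in> pts (ob T (discrete S))"
    for g S z
    using inv_le(1)[of "pr1 (pr1 z)"] inv_le(1)[of "g (pr2 (pr2 z))"] nonexpD(2)[OF that(1)] that(2)
    by (simp add: val_def ob)
  have "\<phi> \<in> pts (weighted_cocones T ?X ?Y)"
  proof -
    have dst_X: "dst ?X x y = ennreal \<bar>real (inv u x) - real (inv u y)\<bar>"
      if "x \<in> pts ?X" "y \<in> pts ?X" for x y
      using that by (simp add: line_def)
    have dst_Y: "dst ?Y (val g z) (val g' w) =
        ennreal \<bar>(real (inv u (pr1 (pr1 z))) - real (inv u (pr1 (pr1 w)))) +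
          (real (inv u (g (pr2 (pr2 z)))) - real (inv u (g' (pr2 (pr2 w)))))\<bar>"
      if "g \<in> nonexp (discrete S) ?X" "z \<in> pts (ob T (discrete S))"
        "g' \<in> nonexp (discrete S) ?X" "w \<in> pts (ob T (discrete S))" for g z g' w S
      using val[OF that(1,2)] val[OF that(3,4)] u by (simp add: line_def val_def algebra_simps)
    have 1: "(\<lambda>z\<in>pts (ob T (discrete S)). val g z) \<in> nonexp (ob T (discrete S)) ?Y"
      if S: "finite S" and g: "g \<in> nonexp (discrete S) ?X" for S g
      unfolding nonexp_def
    proof (intro CollectI conjI ballI)
      show "(\<lambda>z\<in>pts (ob T (discrete S)). val g z) \<in> pts (ob T (discrete S)) \<rightarrow>\<^sub>E pts ?Y"
        using val[OF g] by simp
      fix z w assume z: "z \<in> pts (ob T (discrete S))" and w: "w \<in> pts (ob T (discrete S))"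
      have "dst ?Y (val g z) (val g w) \<le> dst (ob T (discrete S)) z w"
      \<comment> \<open>Over a discrete set only one of the two summands has to be controlled. If
        the points of \<open>S\<close> agree, the \<open>g\<close>-terms cancel and the distance of
        the \<open>A\<close>-coordinates is below the maximum; if some point of \<open>S\<close>
        differs, the right-hand side is infinite.\<close>
      proof (cases "pr2 (pr1 z) = pr2 (pr1 w) \<and> pr2 (pr2 z) = pr2 (pr2 w)")
        case True
        have "dst ?Y (val g z) (val g w) = dst ?X (pr1 (pr1 z)) (pr1 (pr1 w))"
          using z w True by (subst dst_Y[OF g z g w], subst dst_X) (auto simp: ob)
        then show ?thesis
          using z w True by (simp add: ob discrete_def)
      next
        case False
        then have "dst (ob T (discrete S)) z w = \<infinity>"
          using z w by (auto simp: ob discrete_def)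
        then show ?thesis
          by simp
      qed
      then show "dst ?Y ((\<lambda>z\<in>pts (ob T (discrete S)). val g z) z)
          ((\<lambda>z\<in>pts (ob T (discrete S)). val g z) w) \<le> dst (ob T (discrete S)) z w"
        using z w by simp
    qed
    have 2: "\<phi> S \<in> nonexp (hom_space (discrete S) ?X) (hom_space (ob T (discrete S)) ?Y)"
      if S: "finite S" for S
    proof -
      have "dst ?Y (val g z) (val g' z) \<le> dst (hom_space (discrete S) ?X) g g'"
        if g: "g \<in> nonexp (discrete S) ?X" and g': "g' \<in> nonexp (discrete S) ?X"
          and z: "z \<in> pts (ob T (discrete S))" for g g' z
      proof -
        have s: "pr2 (pr2 z) \<in> pts (discrete S)"
          using z by (simp add: ob)
        \<comment> \<open>Here \<open>z\<close> is fixed, so the \<open>A\<close>-coordinates cancel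
          instead and only the change from \<open>g\<close> to \<open>g'\<close> is left.\<close>
        have "dst ?Y (val g z) (val g' z) = dst ?X (g (pr2 (pr2 z))) (g' (pr2 (pr2 z)))"
          using nonexpD(2)[OF g s] nonexpD(2)[OF g' s]
          by (subst dst_Y[OF g z g' z], subst dst_X) auto
        also have "\<dots> \<le> dst (hom_space (discrete S) ?X) g g'"
          using g g' s by (rule dst_le_dst_hom_space)
        finally show ?thesis .
      qed
      then show ?thesis
        using S 1[OF S] by (subst nonexp_def) (auto simp: \<phi>_def dst_hom_space_le_iff)
    qed
    have 3: "\<phi> S (compose S g f) =
        compose (pts (ob T (discrete S))) (\<phi> S' g) (ar T (discrete S) (discrete S') f)"
      if S: "finite S" "finite S'" and f: "f \<in> nonexp (discrete S) (discrete S')"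
        and g: "g \<in> nonexp (discrete S') ?X" for S S' f g
    proof -
      have "compose S g f \<in> nonexp (discrete S) ?X"
        using nonexp_compose[OF f g] by simp
      \<comment> \<open>The action of \<open>f\<close> keeps the \<open>A\<close>-coordinates and
        moves only the points of \<open>S\<close>, so both sides add the same
        \<open>A\<close>-coordinate to \<open>g\<close> after \<open>f\<close>.\<close>
      then show ?thesis
        using S g nonexpD(2)[OF f]
        by (auto simp: \<phi>_def compose_def val_def ar ob fun_eq_iff)
    qed
    show ?thesis
      using 2 3 by (auto simp: mem_weighted_cocones PiE_iff \<phi>_def)
  qed
  then obtain h where h: "h \<in> nonexp (ob T ?X) ?Y" and \<phi>h: "\<phi> = lan_comparison T ?X ?Y h"
    using surj by auto
  \<comment> \<open>From \<open>z\<close> to \<open>w\<close> both coordinates read by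
    \<open>val\<close> rise from 0 to 1. They sit in different factors of the square, so the maximum
    metric counts the change only once.\<close>
  define z where "z = pair (pair (u 0) (u 0)) (pair (u 0) (u 0))"
  define w where "w = pair (pair (u 1) (u 0)) (pair (u 0) (u 1))"
  \<comment> \<open>The identity from the discrete space on the points of \<open>X\<close> acts as
    the identity on the elements of \<open>T\<close>, so \<open>h\<close> is forced to equal
    \<open>val ?i\<close> at every point of \<open>T X\<close>.\<close>
  let ?S = "pts ?X" and ?i = "\<lambda>s\<in>pts ?X. s"
  have i: "?i \<in> nonexp (discrete ?S) ?X"
    using line_in_Met[OF u] by (intro nonexp_discreteI) auto
  have zw: "z \<in> pts (ob T (discrete ?S))" "w \<in> pts (ob T (discrete ?S))"
    by (auto simp: ob z_def w_def)
  have "h t = val ?i t" if "t \<in> pts (ob T (discrete ?S))" for t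
  proof -
    have "\<phi> ?S ?i t = val ?i t"
      using i that by (simp add: \<phi>_def)
    moreover have "\<phi> ?S ?i t = h (ar T (discrete ?S) ?X ?i t)"
      unfolding \<phi>h using i that by (simp add: lan_comparison_def compose_def)
    moreover have "ar T (discrete ?S) ?X ?i t = t"
      using that by (simp add: ar ob)
    ultimately show ?thesis by simp
  qed
  then have "h z = u 0" "h w = u 2"
    using zw u by (auto simp: val_def z_def w_def numeral_2_eq_2)
  moreover have "dst (ob T ?X) z w = 1"
    using u by (simp add: ob z_def w_def)
  moreover have "dst ?Y (h z) (h w) \<le> dst (ob T ?X) z w"
    using zw by (intro nonexpD(3)[OF h]) (auto simp: ob)
  ultimately show False
    using u by simp
qed

theorem corollary1p2:
  assumes "infinite (UNIV :: 'u set)"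
  shows "\<exists>F G :: 'u endofunctor.
           strongly_finitary F \<and> strongly_finitary G \<and> \<not> strongly_finitary (G \<cdot> F)"
proof -
  obtain pair :: "'u \<Rightarrow> 'u \<Rightarrow> 'u" and pr1 pr2 where "pairing pair pr1 pr2"
    using ex_pairing[OF assms] by blast
  then interpret pairing pair pr1 pr2 .
  obtain u :: "nat \<Rightarrow> 'u" where "inj u"
    using infinite_countable_subset[OF assms] by blast
  then show ?thesis
    using strongly_finitary_tensor[OF line_in_Met] strongly_finitary_square
      not_strongly_finitary_square_tensor by blast
qed

end
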